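(* Let $1\le n\le N$ be integers, let $\psi_0\in\mathbb{C}^{2^n}$ be a unit vector, and let $H_j=\mathrm{diag}(k^{(j)}_1,\dots,k^{(j)}_{2^n})$, $j=1,\dots,N$, be linearly independent diagonal matrices with integer entries. Let $U(\boldsymbol{\theta})=e^{i(\theta_1H_1+\dots+\theta_NH_N)}$ for $\boldsymbol{\theta}\in[-\pi,\pi]^N$, let $\mathcal{F}_U(t)$ be its frame potential, and let $W=(W_t)_{t\ge1}$ be the associated random walk (both defined in the context). Then $$\mathcal{F}_U(t)=\mathbb{P}(W_t=0),\qquad t=1,2,\dots$$
   Context: Frame potential: with fidelity $F_U(\boldsymbol{\theta},\boldsymbol{\theta}')=|\langle\psi_0|U(\boldsymbol{\theta})^\dagger U(\boldsymbol{\theta}')|\psi_0\rangle|^2$, set $$\mathcal{F}_U(t)=\frac{1}{(2\pi)^{2N}}\int_{[-\pi,\pi]^{2N}}F_U(\boldsymbol{\theta},\boldsymbol{\theta}')^t\,d\boldsymbol{\theta}\,d\boldsymbol{\theta}'.$$ Random walk: for $x=1,\dots,2^n$ let $\boldsymbol{k}_x=(k^{(1)}_x,\dots,k^{(N)}_x)\in\mathbb{Z}^N$, and let $|x\rangle$ denote the $x$-th standard basis vector of $\mathbb{C}^{2^n}$. Let $X$ be a random index with $\mathbb{P}(X=x)=|\langle\psi_0|x\rangle|^2$, and let $K=\boldsymbol{k}_X$. Let $D=K-K'$, where $K'$ is an independent copy of $K$. Then $W_t=D_1+\dots+D_t$, where $D_1,D_2,\dots$ are independent and distributed as $D$. *)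

theory Defs
  imports "HOL-Probability.Probability"
begin

text \<open>
  Square complex matrices are of type \<^typ>\<open>complex ^ 'q ^ 'q\<close>. On that type the library's
  \<^term>\<open>(*)\<close>, \<^term>\<open>1\<close> and \<^term>\<open>(^)\<close> act entrywise; the matrix product is \<^term>\<open>(**)\<close> and the
  identity is \<^term>\<open>mat 1\<close>. The library's inner product on \<^typ>\<open>complex ^ 'q\<close> is the real part
  of the Hermitian one, so the latter is defined separately.
\<close>

definition braket :: "complex ^ 'q \<Rightarrow> complex ^ 'q \<Rightarrow> complex" where
  "braket \<phi> \<psi> = (\<Sum>x\<in>UNIV. cnj (\<phi> $ x) * \<psi> $ x)"

definition dagger :: "complex ^ 'q ^ 'q \<Rightarrow> complex ^ 'q ^ 'q" where
  "dagger A = map_matrix cnj (transpose A)"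

definition mscale :: "complex \<Rightarrow> complex ^ 'q ^ 'q \<Rightarrow> complex ^ 'q ^ 'q" where
  "mscale c A = map_matrix ((*) c) A"

definition mdiag :: "('q \<Rightarrow> complex) \<Rightarrow> complex ^ 'q ^ 'q" where
  "mdiag d = (\<chi> x y. if x = y then d x else 0)"

definition mexp :: "complex ^ 'q ^ 'q \<Rightarrow> complex ^ 'q ^ 'q" where
  "mexp A = (\<Sum>m. mscale (1 / fact m) (((**) A ^^ m) (mat 1)))"

text \<open>Linear independence of a family: in particular the members are pairwise distinct.\<close>

definition lin_indep_family :: "('p::finite \<Rightarrow> complex ^ 'q ^ 'q) \<Rightarrow> bool" where
  "lin_indep_family H \<longleftrightarrow>
     (\<forall>c :: 'p \<Rightarrow> complex. (\<Sum>j\<in>UNIV. mscale (c j) (H j)) = 0 \<longrightarrow> (\<forall>j. c j = 0))"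

definition evolution :: "('p::finite \<Rightarrow> complex ^ 'q ^ 'q) \<Rightarrow> real ^ 'p \<Rightarrow> complex ^ 'q ^ 'q" where
  "evolution H \<theta> = mexp (mscale \<i> (\<Sum>j\<in>UNIV. mscale (of_real (\<theta> $ j)) (H j)))"

definition fidelity ::
  "complex ^ 'q \<Rightarrow> (real ^ 'p \<Rightarrow> complex ^ 'q ^ 'q) \<Rightarrow> real ^ 'p \<Rightarrow> real ^ 'p \<Rightarrow> real" where
  "fidelity \<psi> U \<theta> \<theta>' = (cmod (braket \<psi> ((dagger (U \<theta>) ** U \<theta>') *v \<psi>)))\<^sup>2"

definition param_cube :: "(real ^ 'p) set" where
  "param_cube = {\<theta>. \<forall>j. \<theta> $ j \<in> {-pi..pi}}"

definition frame_potential ::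
  "complex ^ 'q \<Rightarrow> (real ^ 'p \<Rightarrow> complex ^ 'q ^ 'q) \<Rightarrow> nat \<Rightarrow> real" where
  "frame_potential \<psi> U t =
     1 / (2 * pi) ^ (2 * CARD('p)) *
     (LINT z : param_cube \<times> param_cube | lborel. fidelity \<psi> U (fst z) (snd z) ^ t)"

text \<open>The law of the random index. It is meaningful only for a unit vector, where the weights
  sum to one, because \<^const>\<open>embed_pmf\<close> is unspecified otherwise.\<close>

definition index_pmf :: "complex ^ 'q \<Rightarrow> 'q pmf" where
  "index_pmf \<psi> = embed_pmf (\<lambda>x. (cmod (braket \<psi> (axis x 1)))\<^sup>2)"

lemma pmf_index_pmf:
  fixes \<psi> :: "complex ^ 'q"
  assumes "norm \<psi> = 1"
  shows "pmf (index_pmf \<psi>) x = (cmod (braket \<psi> (axis x 1)))\<^sup>2"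
proof -
  have braket_axis: "cmod (braket \<psi> (axis y 1)) = cmod (\<psi> $ y)" for y
    by (simp add: braket_def axis_def if_distrib if_distribR cong: if_cong)
  have "(\<Sum>y\<in>UNIV. (cmod (\<psi> $ y))\<^sup>2) = 1"
    using assms by (simp add: norm_vec_def L2_set_def)
  then have "(\<integral>\<^sup>+ y. ennreal ((cmod (braket \<psi> (axis y 1)))\<^sup>2) \<partial>count_space UNIV) = 1"
    by (simp add: braket_axis nn_integral_count_space_finite)
  then show ?thesis
    unfolding index_pmf_def by (subst pmf_embed_pmf) auto
qed

definition position_pmf :: "complex ^ 'q \<Rightarrow> ('q \<Rightarrow> int ^ 'p) \<Rightarrow> (int ^ 'p) pmf" where
  "position_pmf \<psi> k = map_pmf k (index_pmf \<psi>)"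

definition step_pmf :: "complex ^ 'q \<Rightarrow> ('q \<Rightarrow> int ^ 'p) \<Rightarrow> (int ^ 'p) pmf" where
  "step_pmf \<psi> k =
     map_pmf (\<lambda>(a, b). a - b) (pair_pmf (position_pmf \<psi> k) (position_pmf \<psi> k))"

definition iid_steps :: "'w measure \<Rightarrow> (int ^ 'p) pmf \<Rightarrow> (nat \<Rightarrow> 'w \<Rightarrow> int ^ 'p) \<Rightarrow> bool" where
  "iid_steps M \<mu> D \<longleftrightarrow>
     prob_space.indep_vars M (\<lambda>_. count_space UNIV) D {1..} \<and>
     (\<forall>i\<ge>1. distr M (count_space UNIV) (D i) = measure_pmf \<mu>)"

definition walk :: "(nat \<Rightarrow> 'w \<Rightarrow> int ^ 'p) \<Rightarrow> nat \<Rightarrow> 'w \<Rightarrow> int ^ 'p" where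
  "walk D t \<omega> = (\<Sum>i = 1..t. D i \<omega>)"

end

theory Submission
  imports Defs
begin

text \<open>
  Since the generators are diagonal, the overlap of the two evolved states is the characteristic
  function of the position \<open>K\<close> at \<open>\<theta>' - \<theta>\<close>. Its squared modulus is the characteristic function of
  the symmetrised step \<open>K - K'\<close>, whose \<open>t\<close>-th power is that of \<open>W\<^sub>t\<close>. As \<open>W\<^sub>t\<close> takes finitely many
  values, this is a trigonometric polynomial in \<open>(\<theta>, \<theta>')\<close>, and averaging over the cube extracts its
  constant coefficient \<open>P(W\<^sub>t = 0)\<close>.
\<close>

section \<open>Integrals of characters over the cube\<close>

lemma integral_cis_period:
  fixes a :: real
  assumes "a \<in> \<int>"
  shows "(LINT x|lborel. indicator {-pi..pi} x *\<^sub>R cis (a * x)) = (if a = 0 then of_real (2 * pi) else 0)"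
    and "integrable lborel (\<lambda>x. indicator {-pi..pi} x *\<^sub>R cis (a * x))"
proof -
  have "(LINT x|lborel. indicator {-pi..pi} x *\<^sub>R cis (a * x)) = 0" if "a \<noteq> 0"
  proof -
    have "((\<lambda>x. cis (a * x) / (\<i> * of_real a)) has_vector_derivative cis (a * x)) (at x within {-pi..pi})"
      for x
      unfolding has_vector_derivative_def using that
      by (auto intro!: derivative_eq_intros simp: scaleR_conv_of_real fun_eq_iff divide_simps complex_eq_iff)
    then have "(LINT x|lborel. indicator {-pi..pi} x *\<^sub>R cis (a * x)) =
        cis (a * pi) / (\<i> * of_real a) - cis (a * - pi) / (\<i> * of_real a)"
      by (intro integral_FTC_Icc continuous_intros) auto
    \<comment> \<open>The phases at the two endpoints differ by \<open>2 * pi * a\<close>, a whole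
      number of turns for an integer \<open>a\<close>, so the boundary values of the antiderivative
      cancel.\<close>
    moreover have "cis (a * - pi) * cis (2 * pi * a) = cis (a * pi)"
      by (simp add: cis_mult algebra_simps)
    ultimately show ?thesis
      using cis_multiple_2pi[OF assms] by simp
  qed
  moreover have "(LINT x|lborel. indicator {-pi..pi} x *\<^sub>R (1::complex)) = of_real (2 * pi)"
    by (simp add: scaleR_conv_of_real)
  ultimately show "(LINT x|lborel. indicator {-pi..pi} x *\<^sub>R cis (a * x)) =
      (if a = 0 then of_real (2 * pi) else 0)"
    by simp
  show "integrable lborel (\<lambda>x. indicator {-pi..pi} x *\<^sub>R cis (a * x))"
    by (rule borel_integrable_compact) (auto intro!: continuous_on_cis continuous_on_mult_left continuous_on_id)
qed

text \<open>Lebesgue measure on a Euclidean space is the image of a product of one-dimensional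
  Lebesgue measures under assembling coordinates, so Fubini for products of one-variable functions
  carries over.\<close>

lemma integral_lborel_prod:
  fixes f :: "'a::euclidean_space \<Rightarrow> real \<Rightarrow> 'b::{real_normed_field, banach, second_countable_topology}"
  assumes "\<And>b. b \<in> Basis \<Longrightarrow> integrable lborel (f b)"
  shows "(LINT x|lborel. (\<Prod>b\<in>Basis. f b (x \<bullet> b))) = (\<Prod>b\<in>Basis. (LINT x|lborel. f b x))"
proof -
  interpret product_sigma_finite "\<lambda>_::'a. lborel :: real measure" ..
  have [measurable]: "f b \<in> borel_measurable borel" if "b \<in> Basis" for b
    using assms[OF that] by auto
  have "(LINT x|lborel. (\<Prod>b\<in>Basis. f b (x \<bullet> b))) =
      (LINT x|(\<Pi>\<^sub>M b\<in>Basis. lborel). (\<Prod>b\<in>Basis. f b ((\<Sum>c\<in>Basis. x c *\<^sub>R c) \<bullet> b)))"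
    by (subst lborel_eq, subst integral_distr) measurable
  also have "\<dots> = (LINT x|(\<Pi>\<^sub>M b\<in>Basis. lborel). (\<Prod>b\<in>Basis. f b (x b)))"
    by (intro Bochner_Integration.integral_cong prod.cong) auto
  also have "\<dots> = (\<Prod>b\<in>Basis. (LINT x|lborel. f b x))"
    by (rule product_integral_prod) (auto intro: assms)
  finally show ?thesis .
qed

lemma cis_sum: "finite A \<Longrightarrow> cis (\<Sum>x\<in>A. f x) = (\<Prod>x\<in>A. cis (f x))"
  by (induction A rule: finite_induct) (auto simp flip: cis_mult)

text \<open>Orthogonality of characters on the torus: the integrand factors over the coordinates,
  and a single nonzero integer frequency makes its factor, and so the product, vanish.\<close>

lemma integral_cis_cube:
  fixes v :: "'a::euclidean_space"
  assumes "\<And>b. b \<in> Basis \<Longrightarrow> v \<bullet> b \<in> \<int>"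
  shows "(LINT z|lborel. indicator {z. \<forall>b\<in>Basis. z \<bullet> b \<in> {-pi..pi}} z *\<^sub>R cis (v \<bullet> z)) =
    (if v = 0 then of_real (2 * pi) ^ DIM('a) else 0)"
proof -
  have "indicator {z. \<forall>b\<in>Basis. z \<bullet> b \<in> {-pi..pi}} z *\<^sub>R cis (v \<bullet> z) =
      (\<Prod>b\<in>Basis. indicator {-pi..pi} (z \<bullet> b) *\<^sub>R cis ((v \<bullet> b) * (z \<bullet> b)))" for z
  proof -
    have "cis (v \<bullet> z) = (\<Prod>b\<in>Basis. cis ((v \<bullet> b) * (z \<bullet> b)))"
      by (subst euclidean_inner) (simp add: cis_sum)
    then show ?thesis
      by (auto simp: indicator_def)
  qed
  then have "(LINT z|lborel. indicator {z. \<forall>b\<in>Basis. z \<bullet> b \<in> {-pi..pi}} z *\<^sub>R cis (v \<bullet> z)) =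
      (\<Prod>b\<in>Basis. if v \<bullet> b = 0 then of_real (2 * pi) else 0)"
    by (simp only:, subst integral_lborel_prod) (simp_all add: integral_cis_period assms)
  also have "\<dots> = (if v = 0 then of_real (2 * pi) ^ DIM('a) else 0)"
    using euclidean_all_zero_iff[of v] by auto
  finally show ?thesis .
qed

lemma integrable_cis_cube:
  fixes v :: "'a::euclidean_space"
  shows "integrable lborel (\<lambda>z. indicator {z. \<forall>b\<in>Basis. z \<bullet> b \<in> {-pi..pi}} z *\<^sub>R cis (v \<bullet> z))"
proof -
  have "{z::'a. \<forall>b\<in>Basis. z \<bullet> b \<in> {-pi..pi}} = cbox (- pi *\<^sub>R One) (pi *\<^sub>R One)"
    by (auto simp: mem_box)
  moreover have "continuous_on A (\<lambda>z. cis (v \<bullet> z))" for A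
    by (intro continuous_on_cis continuous_on_inner continuous_on_const continuous_on_id)
  ultimately show ?thesis
    by (simp only: borel_integrable_compact compact_cbox)
qed

section \<open>Calculus of diagonal matrices\<close>

lemma mscale_mdiag: "mscale c (mdiag d) = mdiag (\<lambda>x. c * d x)"
  by (simp add: mscale_def mdiag_def vec_eq_iff map_matrix_def)

lemma sum_mdiag: "(\<Sum>j\<in>A. mdiag (d j)) = mdiag (\<lambda>x. \<Sum>j\<in>A. d j x)"
  by (auto simp: mdiag_def vec_eq_iff)

lemma mdiag_mult: "mdiag d ** mdiag e = mdiag (\<lambda>x. d x * e x)"
  by (auto simp: mdiag_def vec_eq_iff matrix_matrix_mult_def mult_delta_left)

lemma dagger_mdiag: "dagger (mdiag d) = mdiag (\<lambda>x. cnj (d x))"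
  by (auto simp: mdiag_def dagger_def vec_eq_iff map_matrix_def transpose_def)

lemma mdiag_mult_vec: "mdiag d *v \<psi> = (\<chi> x. d x * \<psi> $ x)"
  by (auto simp: mdiag_def vec_eq_iff matrix_vector_mult_def mult_delta_left)

lemma mdiag_funpow: "((**) (mdiag d) ^^ m) (mat 1) = mdiag (\<lambda>x. d x ^ m)"
proof (induction m)
  case 0
  show ?case by (simp add: mat_def mdiag_def)
next
  case (Suc m)
  then show ?case by (simp add: mdiag_mult)
qed

text \<open>Matrices converge entrywise and diagonal powers act on each diagonal entry separately,
  so the series splits into scalar exponential series on the diagonal and zeros off it.\<close>

lemma mexp_mdiag: "mexp (mdiag d) = mdiag (\<lambda>x. exp (d x))"
proof -
  have "(\<lambda>n. \<Sum>m<n. mdiag (\<lambda>x. 1 / fact m * d x ^ m)) \<longlonglongrightarrow> mdiag (\<lambda>x. exp (d x))"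
  proof (intro vec_tendstoI)
    fix x y
    have "(\<lambda>m. 1 / fact m * d x ^ m) sums exp (d x)"
      using exp_converges[of "d x"] by (simp add: scaleR_conv_of_real field_simps)
    then show "(\<lambda>n. (\<Sum>m<n. mdiag (\<lambda>x. 1 / fact m * d x ^ m)) $ x $ y) \<longlonglongrightarrow> mdiag (\<lambda>x. exp (d x)) $ x $ y"
      unfolding sum_mdiag by (auto simp: mdiag_def sums_def)
  qed
  then show ?thesis
    unfolding mexp_def mdiag_funpow mscale_mdiag by (intro sums_unique[symmetric]) (simp add: sums_def)
qed

section \<open>Fidelity as a characteristic function\<close>

definition real_vec :: "int ^ 'p \<Rightarrow> real ^ 'p" where
  "real_vec w = (\<chi> j. of_int (w $ j))"

lemma real_vec_diff: "real_vec (v - w) = real_vec v - real_vec w"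
  and real_vec_eq_0_iff: "real_vec w = 0 \<longleftrightarrow> w = 0"
  by (auto simp: real_vec_def vec_eq_iff)

lemma real_vec_sum: "real_vec (\<Sum>i\<in>A. w i) = (\<Sum>i\<in>A. real_vec (w i))"
  by (simp add: real_vec_def vec_eq_iff)

lemma evolution_mdiag:
  assumes "\<And>j. H j = mdiag (\<lambda>x. of_int (k x $ j))"
  shows "evolution H \<theta> = mdiag (\<lambda>x. cis (real_vec (k x) \<bullet> \<theta>))"
  by (simp add: evolution_def assms mscale_mdiag sum_mdiag mexp_mdiag cis_conv_exp real_vec_def
      inner_vec_def mult.commute)

text \<open>Both evolutions are diagonal, so taking the adjoint of the first and multiplying
  subtracts phases; the overlap is then a mean over the random index that depends only on \<theta>'
  - \<theta>.\<close>

lemma fidelity_eq_char_step: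
  fixes k :: "'q::finite \<Rightarrow> int ^ 'p"
  assumes "norm \<psi> = 1" and "\<And>j. H j = mdiag (\<lambda>x. of_int (k x $ j))"
  shows "of_real (fidelity \<psi> (evolution H) \<theta> \<theta>') =
    (LINT d|measure_pmf (step_pmf \<psi> k). cis (real_vec d \<bullet> (\<theta>' - \<theta>)))"
proof -
  define p where "p = pmf (index_pmf \<psi>)"
  define c where "c x = cis (real_vec (k x) \<bullet> (\<theta>' - \<theta>))" for x
  have cnj_c: "cnj (c x) = cis (- (real_vec (k x) \<bullet> (\<theta>' - \<theta>)))" for x
    by (simp add: c_def cis_cnj)
  have p: "of_real (p x) = cnj (\<psi> $ x) * \<psi> $ x" for x
    using assms(1) by (simp add: p_def pmf_index_pmf complex_norm_square braket_def axis_def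
        if_distrib if_distribR mult.commute del: of_real_power cong: if_cong)
  have "braket \<psi> ((dagger (evolution H \<theta>) ** evolution H \<theta>') *v \<psi>) = (\<Sum>x\<in>UNIV. of_real (p x) * c x)"
    by (simp add: evolution_mdiag[OF assms(2)] dagger_mdiag mdiag_mult mdiag_mult_vec braket_def
        p c_def cis_cnj cis_mult inner_diff_right mult_ac)
  then have "of_real (fidelity \<psi> (evolution H) \<theta> \<theta>') =
      (\<Sum>x\<in>UNIV. of_real (p x) * c x) * cnj (\<Sum>x\<in>UNIV. of_real (p x) * c x)"
    unfolding fidelity_def by (simp only: complex_norm_square)
  \<comment> \<open>Here \<open>x\<close> comes from the overlap and \<open>y\<close> from its
    conjugate, whose reversed phase produces the difference \<open>k x - k y\<close>. The weights
    \<open>p x * p y\<close> are those of two independent indices.\<close>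
  also have "\<dots> = (\<Sum>x\<in>UNIV. \<Sum>y\<in>UNIV. of_real (p x * p y) * cis (real_vec (k x - k y) \<bullet> (\<theta>' - \<theta>)))"
    by (simp add: sum_product cnj_c real_vec_diff inner_diff_left mult_ac flip: cis_divide)
       (simp add: c_def divide_inverse mult_ac)
  also have "\<dots> = (\<Sum>z\<in>UNIV. pmf (pair_pmf (index_pmf \<psi>) (index_pmf \<psi>)) z *\<^sub>R
      cis (real_vec (k (fst z) - k (snd z)) \<bullet> (\<theta>' - \<theta>)))"
    by (simp add: sum.cartesian_product p_def pmf_pair scaleR_conv_of_real case_prod_unfold
        flip: UNIV_Times_UNIV)
       (auto intro!: sum.cong simp: pmf_pair)
  also have "\<dots> = (LINT z|measure_pmf (pair_pmf (index_pmf \<psi>) (index_pmf \<psi>)).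
      cis (real_vec (k (fst z) - k (snd z)) \<bullet> (\<theta>' - \<theta>)))"
    by (rule integral_measure_pmf[symmetric]) auto
  also have "\<dots> = (LINT d|measure_pmf (step_pmf \<psi> k). cis (real_vec d \<bullet> (\<theta>' - \<theta>)))"
    by (simp add: step_pmf_def position_pmf_def case_prod_unfold flip: map_pair)
  finally show ?thesis .
qed

section \<open>Characteristic function and values of the walk\<close>

lemma finite_set_step_pmf: "finite (set_pmf (step_pmf \<psi> (k :: 'q::finite \<Rightarrow> int ^ 'p)))"
  by (simp add: step_pmf_def position_pmf_def)

text \<open>The exponential turns the sum of the steps into a product, independence factors its
  expectation, and the common law makes all factors equal.\<close>

lemma
  fixes D :: "nat \<Rightarrow> 'w \<Rightarrow> int ^ 'p"
  assumes "prob_space M" and "iid_steps M \<mu> D"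
  shows measurable_iid_step: "i \<ge> 1 \<Longrightarrow> D i \<in> measurable M (count_space UNIV)"
    and AE_iid_step: "i \<ge> 1 \<Longrightarrow> AE \<omega> in M. D i \<omega> \<in> set_pmf \<mu>"
    and char_walk: "(LINT \<omega>|M. cis (real_vec (walk D t \<omega>) \<bullet> \<phi>)) =
      (LINT d|measure_pmf \<mu>. cis (real_vec d \<bullet> \<phi>)) ^ t"
proof -
  interpret prob_space M by fact
  have indep: "indep_vars (\<lambda>_. count_space UNIV) D {1..}"
    and dist: "\<And>i. i \<ge> 1 \<Longrightarrow> distr M (count_space UNIV) (D i) = measure_pmf \<mu>"
    using assms(2) by (auto simp: iid_steps_def)
  show meas: "D i \<in> measurable M (count_space UNIV)" if "i \<ge> 1" for i
    using indep that by (auto simp: indep_vars_def)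
  show "AE \<omega> in M. D i \<omega> \<in> set_pmf \<mu>" if "i \<ge> 1" for i
  proof -
    have "AE d in distr M (count_space UNIV) (D i). d \<in> set_pmf \<mu>"
      unfolding dist[OF that] by (rule AE_pmfI)
    then show ?thesis
      by (subst (asm) AE_distr_iff) (use meas[OF that] in auto)
  qed
  have cis_meas: "(\<lambda>d. cis (real_vec d \<bullet> \<phi>)) \<in> measurable (count_space UNIV) borel"
    by simp
  have "indep_vars (\<lambda>_. borel) (\<lambda>i \<omega>. cis (real_vec (D i \<omega>) \<bullet> \<phi>)) {1..}"
    by (rule indep_vars_compose2[OF indep]) simp
  then have ind: "indep_vars (\<lambda>_. borel) (\<lambda>i \<omega>. cis (real_vec (D i \<omega>) \<bullet> \<phi>)) {1..t}"
    by (rule indep_vars_subset) auto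
  have "(LINT \<omega>|M. cis (real_vec (walk D t \<omega>) \<bullet> \<phi>)) =
      (LINT \<omega>|M. (\<Prod>i\<in>{1..t}. cis (real_vec (D i \<omega>) \<bullet> \<phi>)))"
    by (simp add: walk_def real_vec_sum inner_sum_left cis_sum)
  also have "\<dots> = (\<Prod>i\<in>{1..t}. (LINT \<omega>|M. cis (real_vec (D i \<omega>) \<bullet> \<phi>)))"
  proof (rule indep_vars_lebesgue_integral[OF _ ind])
    fix i assume "i \<in> {1..t}"
    then have "(\<lambda>\<omega>. cis (real_vec (D i \<omega>) \<bullet> \<phi>)) \<in> borel_measurable M"
      using measurable_compose[OF meas cis_meas] by simp
    then show "integrable M (\<lambda>\<omega>. cis (real_vec (D i \<omega>) \<bullet> \<phi>))"
      by (intro integrable_const_bound[where B = 1]) auto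
  qed simp
  also have "\<dots> = (\<Prod>i\<in>{1..t}. (LINT d|measure_pmf \<mu>. cis (real_vec d \<bullet> \<phi>)))"
  proof (intro prod.cong refl)
    fix i assume "i \<in> {1..t}"
    then have "i \<ge> 1" by simp
    show "(LINT \<omega>|M. cis (real_vec (D i \<omega>) \<bullet> \<phi>)) = (LINT d|measure_pmf \<mu>. cis (real_vec d \<bullet> \<phi>))"
      unfolding dist[OF \<open>i \<ge> 1\<close>, symmetric] using meas[OF \<open>i \<ge> 1\<close>] by (subst integral_distr) auto
  qed
  finally show "(LINT \<omega>|M. cis (real_vec (walk D t \<omega>) \<bullet> \<phi>)) =
      (LINT d|measure_pmf \<mu>. cis (real_vec d \<bullet> \<phi>)) ^ t"
    by simp
qed


text \<open>Grouping the expectation by the value of the walk gives a trigonometric polynomial with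
  the point probabilities as coefficients. One set \<open>S\<close> serves every \<phi>, so the sum
  can later be exchanged with the integral over the parameters.\<close>

lemma char_walk_finite:
  fixes D :: "nat \<Rightarrow> 'w \<Rightarrow> int ^ 'p"
  assumes "prob_space M" and "iid_steps M \<mu> D" and "finite (set_pmf \<mu>)"
  obtains S where "finite S" "0 \<in> S"
    "\<And>\<phi>. (LINT d|measure_pmf \<mu>. cis (real_vec d \<bullet> \<phi>)) ^ t =
      (\<Sum>w\<in>S. measure M {\<omega> \<in> space M. walk D t \<omega> = w} *\<^sub>R cis (real_vec w \<bullet> \<phi>))"
proof
  interpret prob_space M by fact
  \<comment> \<open>All sums of \<open>t\<close> points of the support. For a general \<mu> these
    may miss 0, which is inserted so that the constant term is always present; if unreachable, it
    has probability 0.\<close>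
  let ?S = "insert 0 ((\<lambda>g. \<Sum>i = 1..t. g i) ` (PiE {1..t} (\<lambda>_. set_pmf \<mu>)))"
  let ?E = "\<lambda>w. {\<omega> \<in> space M. walk D t \<omega> = w}"
  show fin: "finite ?S"
    using assms(3) by (auto intro: finite_PiE)
  have meas: "walk D t \<in> measurable M (count_space UNIV)"
  proof (induction t)
    case (Suc t)
    have "D (Suc t) \<in> measurable M (count_space UNIV)"
      using measurable_iid_step[OF assms(1,2)] by simp
    with Suc have "(\<lambda>\<omega>. walk D t \<omega> + D (Suc t) \<omega>) \<in> measurable M (count_space UNIV)"
      by measurable
    then show ?case
      by (simp add: walk_def cong: measurable_cong)
  qed (simp add: walk_def cong: measurable_cong)
  have events [measurable]: "?E w \<in> events" for w
    using measurable_sets[OF meas, of "{w}"] by (simp add: vimage_def Int_def conj_commute)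
  have "AE \<omega> in M. \<forall>i\<in>{1..t}. D i \<omega> \<in> set_pmf \<mu>"
    using AE_iid_step[OF assms(1,2)] by (intro AE_finite_allI) auto
  then have in_S: "AE \<omega> in M. walk D t \<omega> \<in> ?S"
  proof eventually_elim
    case (elim \<omega>)
    \<comment> \<open>Members of \<open>PiE\<close> are \<open>undefined\<close> outside the index
      set, hence the restriction; it leaves the sum unchanged.\<close>
    then have "restrict (\<lambda>i. D i \<omega>) {1..t} \<in> PiE {1..t} (\<lambda>_. set_pmf \<mu>)"
      by auto
    moreover have "walk D t \<omega> = (\<Sum>i = 1..t. restrict (\<lambda>i. D i \<omega>) {1..t} i)"
      by (simp add: walk_def)
    ultimately show ?case
      by blast
  qed
  fix \<phi>
  have "(LINT d|measure_pmf \<mu>. cis (real_vec d \<bullet> \<phi>)) ^ t = (LINT \<omega>|M. cis (real_vec (walk D t \<omega>) \<bullet> \<phi>))"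
    by (rule char_walk[OF assms(1,2), symmetric])
  also have "\<dots> = (LINT \<omega>|M. (\<Sum>w\<in>?S. indicator (?E w) \<omega> *\<^sub>R cis (real_vec w \<bullet> \<phi>)))"
  proof (rule integral_cong_AE)
    show "(\<lambda>\<omega>. cis (real_vec (walk D t \<omega>) \<bullet> \<phi>)) \<in> borel_measurable M"
      by (rule measurable_compose[OF meas]) simp
    show "(\<lambda>\<omega>. \<Sum>w\<in>?S. indicator (?E w) \<omega> *\<^sub>R cis (real_vec w \<bullet> \<phi>)) \<in> borel_measurable M"
      by measurable
    show "AE \<omega> in M. cis (real_vec (walk D t \<omega>) \<bullet> \<phi>) =
        (\<Sum>w\<in>?S. indicator (?E w) \<omega> *\<^sub>R cis (real_vec w \<bullet> \<phi>))"
      using in_S AE_space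
    proof eventually_elim
      case (elim \<omega>)
      \<comment> \<open>The events \<open>?E w\<close> are disjoint, so only the actual position of
        the walk contributes.\<close>
      have "(\<Sum>w\<in>?S. indicator (?E w) \<omega> *\<^sub>R cis (real_vec w \<bullet> \<phi>)) =
          (\<Sum>w\<in>?S. if w = walk D t \<omega> then cis (real_vec w \<bullet> \<phi>) else 0)"
        using elim by (intro sum.cong) auto
      also have "\<dots> = cis (real_vec (walk D t \<omega>) \<bullet> \<phi>)"
        using elim(1) fin by (subst sum.delta) auto
      finally show ?case ..
    qed
  qed
  also have "\<dots> = (\<Sum>w\<in>?S. (LINT \<omega>|M. indicator (?E w) \<omega> *\<^sub>R cis (real_vec w \<bullet> \<phi>)))"
    by (intro Bochner_Integration.integral_sum integrable_scaleR_left integrable_real_indicator)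
       (auto simp: emeasure_eq_measure)
  also have "\<dots> = (\<Sum>w\<in>?S. measure M (?E w) *\<^sub>R cis (real_vec w \<bullet> \<phi>))"
    by (simp add: integral_scaleR_left integrable_real_indicator emeasure_eq_measure
        Int_absorb2 sets.sets_into_space)
  finally show "(LINT d|measure_pmf \<mu>. cis (real_vec d \<bullet> \<phi>)) ^ t =
      (\<Sum>w\<in>?S. measure M (?E w) *\<^sub>R cis (real_vec w \<bullet> \<phi>))" .
qed simp

section \<open>Averaging over the parameter cube\<close>

lemma param_cube_Times:
  "(param_cube \<times> param_cube :: ((real ^ 'p) \<times> (real ^ 'p)) set) =
    {z. \<forall>b\<in>Basis. z \<bullet> b \<in> {-pi..pi}}"
proof -
  have cube: "(param_cube :: (real ^ 'p) set) = {\<theta>. \<forall>b\<in>Basis. \<theta> \<bullet> b \<in> {-pi..pi}}"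
    by (auto simp: param_cube_def Basis_vec_def inner_axis)
  \<comment> \<open>Basis vectors of the product space are those of either factor padded with 0, so
    the two cubes form a single cube of twice the dimension.\<close>
  show ?thesis
    unfolding cube by (force simp: Basis_prod_def)
qed

theorem theorem1:
  fixes n N :: nat
    and \<psi>\<^sub>0 :: "complex ^ 'q"
    and k :: "'q \<Rightarrow> int ^ 'p"
    and H :: "'p \<Rightarrow> complex ^ 'q ^ 'q"
    and M :: "'w measure"
    and D :: "nat \<Rightarrow> 'w \<Rightarrow> int ^ 'p"
    and t :: nat
  assumes "1 \<le> n" and "n \<le> N"
    and "CARD('q) = 2 ^ n" and "CARD('p) = N"
    and "norm \<psi>\<^sub>0 = 1"
    and "\<And>j. H j = mdiag (\<lambda>x. of_int (k x $ j))"
    and "lin_indep_family H"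
    and "prob_space M"
    and "iid_steps M (step_pmf \<psi>\<^sub>0 k) D"
    and "1 \<le> t"
  shows "frame_potential \<psi>\<^sub>0 (evolution H) t = measure M {\<omega> \<in> space M. walk D t \<omega> = 0}"
proof -
  let ?C = "param_cube \<times> param_cube :: ((real ^ 'p) \<times> (real ^ 'p)) set"
  let ?P = "\<lambda>w. measure M {\<omega> \<in> space M. walk D t \<omega> = w}"
  \<comment> \<open>The frequency in the product space: \<open>?v w \<bullet> (\<theta>, \<theta>') = w \<bullet> (\<theta>' - \<theta>)\<close>. Integrating over both
    parameters at once avoids Fubini.\<close>
  let ?v = "\<lambda>w :: int ^ 'p. (- real_vec w, real_vec w)"
  obtain S where S: "finite S" "0 \<in> S"
    and char: "\<And>\<phi>. (LINT d|measure_pmf (step_pmf \<psi>\<^sub>0 k). cis (real_vec d \<bullet> \<phi>)) ^ t =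
      (\<Sum>w\<in>S. ?P w *\<^sub>R cis (real_vec w \<bullet> \<phi>))"
    using char_walk_finite[OF assms(8,9) finite_set_step_pmf] by blast
  have fid: "of_real (fidelity \<psi>\<^sub>0 (evolution H) (fst z) (snd z) ^ t) = (\<Sum>w\<in>S. ?P w *\<^sub>R cis (?v w \<bullet> z))" for z
    unfolding of_real_power fidelity_eq_char_step[OF assms(5,6)] char
    by (simp add: inner_prod_def inner_diff_right)
  have ints: "?v w \<bullet> b \<in> \<int>" if "b \<in> Basis" for w b
    using that by (auto simp: Basis_prod_def Basis_vec_def inner_axis real_vec_def)
  \<comment> \<open>The real integral is computed in the complex numbers, where the characters live;
    injectivity of \<open>of_real\<close> brings the result back.\<close>
  have "complex_of_real (LINT z : ?C | lborel. fidelity \<psi>\<^sub>0 (evolution H) (fst z) (snd z) ^ t) =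
      (LINT z|lborel. indicator ?C z *\<^sub>R complex_of_real (fidelity \<psi>\<^sub>0 (evolution H) (fst z) (snd z) ^ t))"
    unfolding set_lebesgue_integral_def
    by (subst integral_complex_of_real[symmetric]) (simp add: scaleR_conv_of_real)
  also have "\<dots> = (LINT z|lborel. (\<Sum>w\<in>S. ?P w *\<^sub>R (indicator ?C z *\<^sub>R cis (?v w \<bullet> z))))"
    unfolding fid by (simp add: scaleR_sum_right mult.commute)
  also have "\<dots> = (\<Sum>w\<in>S. ?P w *\<^sub>R (LINT z|lborel. indicator ?C z *\<^sub>R cis (?v w \<bullet> z)))"
    unfolding param_cube_Times
    by (simp only: Bochner_Integration.integral_sum integrable_scaleR_right integrable_cis_cube
        integral_scaleR_right)
  \<comment> \<open>By orthogonality only the zero frequency survives, which means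
    \<open>w = 0\<close>. Its integral is the volume of the double cube, exactly the normalisation
    in \<open>frame_potential\<close>.\<close>
  also have "\<dots> = (\<Sum>w\<in>S. if w = 0 then of_real (?P w * (2 * pi) ^ (2 * CARD('p))) else 0)"
  proof (intro sum.cong refl)
    fix w
    have "?v w = 0 \<longleftrightarrow> w = 0"
      by (simp add: real_vec_eq_0_iff zero_prod_def)
    moreover have "DIM((real ^ 'p) \<times> (real ^ 'p)) = 2 * CARD('p)"
      by simp
    ultimately have "(LINT z|lborel. indicator ?C z *\<^sub>R cis (?v w \<bullet> z)) =
        (if w = 0 then of_real (2 * pi) ^ (2 * CARD('p)) else 0)"
      unfolding param_cube_Times using integral_cis_cube[OF ints, of w] by presburger
    then show "?P w *\<^sub>R (LINT z|lborel. indicator ?C z *\<^sub>R cis (?v w \<bullet> z)) =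
        (if w = 0 then of_real (?P w * (2 * pi) ^ (2 * CARD('p))) else 0)"
      by (simp only: scaleR_conv_of_real of_real_mult of_real_power mult_zero_right split: if_split) simp
  qed
  also have "\<dots> = of_real (?P 0 * (2 * pi) ^ (2 * CARD('p)))"
    using S by simp
  finally have "(LINT z : ?C | lborel. fidelity \<psi>\<^sub>0 (evolution H) (fst z) (snd z) ^ t) =
      ?P 0 * (2 * pi) ^ (2 * CARD('p))"
    by (simp only: of_real_eq_iff)
  then show ?thesis
    by (simp add: frame_potential_def)
qed

end
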